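(* Let $g\in\mathbb{C}^N$ and let $m\le N$. Assume that the collection $\{T_i g : 1\le i\le m\}$ is linearly independent in $\mathbb{C}^N$. Then there exists a subcollection $\{l_1,\dots,l_m\}$ of $m$ distinct indices in $\{1,\dots,N\}$ such that $\widehat g(\lambda_{l_k})\neq 0$ for all $k=1,\dots,m$.
   Context: Let $G$ be an undirected, connected, weighted graph with vertex set $\mathcal V=\{1,\dots,N\}$, and let $A$ be an $N\times N$ diagonalizable matrix associated with $G$ (for example its adjacency matrix or its graph Laplacian), with eigenvalues $\lambda_1,\dots,\lambda_N$ (listed with multiplicity) and corresponding eigenvectors $\chi_1,\dots,\chi_N$ forming an orthonormal basis of $\mathbb{C}^N$. A signal $f:\mathcal V\to\mathbb{C}$ is identified with the vector $(f(1),\dots,f(N))\in\mathbb{C}^N$. The graph Fourier transform of $f\in\mathbb{C}^N$ is $\widehat f(\lambda_l)=\sum_{n=1}^N f(n)\overline{\chi_l(n)}$, $l=1,\dots,N$ (indexed by $l$). The generalized convolution is $(f\ast g)(n)=\sum_{l=1}^N \widehat f(\lambda_l)\widehat g(\lambda_l)\chi_l(n)$. For $i=1,\dots,N$, $\delta_i\in\mathbb{C}^N$ is given by $\delta_i(n)=1$ if $n=i$ and $0$ otherwise, and the generalized translation is $T_i f=\sqrt N\,(f\ast\delta_i)$. Collections such as $\{T_i g:1\le i\le m\}$ are regarded as families indexed by $i$. *)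

theory Defs
  imports
    "Jordan_Normal_Form.Jordan_Normal_Form"
    "Jordan_Normal_Form.VS_Connect"
    "Graph_Theory.Graph_Theory"
begin

text \<open>
  Vertices, coordinates and eigenpairs are numbered from 0, as is usual for vectors and matrices in
  this library: the vertex set is \<open>{..<N}\<close>, and index \<open>i\<close> stands for \<open>i + 1\<close> in 1-based notation.
  A signal is an element of \<open>carrier_vec N\<close>.
\<close>

text \<open>
  An undirected graph is a symmetric arc relation, and the weight of an edge does not depend on its
  direction. Loops are allowed and no sign is imposed on the weights. Connectedness
  includes that the graph has a vertex.
\<close>

definition connected_weighted_graph ::
    "nat \<Rightarrow> nat pair_pre_digraph \<Rightarrow> (nat \<times> nat) weight_fun \<Rightarrow> bool" where
  "connected_weighted_graph N G w \<longleftrightarrow>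
     pair_pseudo_graph G \<and> pverts G = {..<N} \<and>
     Digraph_Component.connected (with_proj G) \<and>
     (\<forall>u v. (u, v) \<in> parcs G \<longrightarrow> w (u, v) = w (v, u))"

definition diagonalizable :: "complex mat \<Rightarrow> bool" where
  "diagonalizable A \<longleftrightarrow> (\<exists>D. diagonal_mat D \<and> similar_mat A D)"

definition orthonormal_basis :: "nat \<Rightarrow> (nat \<Rightarrow> complex vec) \<Rightarrow> bool" where
  "orthonormal_basis N \<chi> \<longleftrightarrow>
     (\<forall>k<N. \<forall>l<N. \<chi> k \<bullet>c \<chi> l = (if k = l then 1 else 0)) \<and>
     vectorspace.basis class_ring (module_vec TYPE(complex) N) (\<chi> ` {..<N})"

text \<open>
  The transform is indexed by \<open>l\<close> rather than by the \<open>l\<close>th eigenvalue: eigenvalues may repeat,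
  so \<open>gft N \<chi> f l\<close> need not be determined by that eigenvalue.
\<close>

definition gft :: "nat \<Rightarrow> (nat \<Rightarrow> complex vec) \<Rightarrow> complex vec \<Rightarrow> nat \<Rightarrow> complex" where
  "gft N \<chi> f l = (\<Sum>n<N. f $ n * cnj (\<chi> l $ n))"

definition gconv ::
    "nat \<Rightarrow> (nat \<Rightarrow> complex vec) \<Rightarrow> complex vec \<Rightarrow> complex vec \<Rightarrow> complex vec" where
  "gconv N \<chi> f g = vec N (\<lambda>n. \<Sum>l<N. gft N \<chi> f l * gft N \<chi> g l * \<chi> l $ n)"

definition gtranslate ::
    "nat \<Rightarrow> (nat \<Rightarrow> complex vec) \<Rightarrow> nat \<Rightarrow> complex vec \<Rightarrow> complex vec" where
  "gtranslate N \<chi> i f = complex_of_real (sqrt (real N)) \<cdot>\<^sub>v gconv N \<chi> f (unit_vec N i)"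

text \<open>
  Independence of an indexed family. The library predicate \<open>lin_dep\<close> concerns sets, so
  repetitions in the family have to be excluded separately.
\<close>

definition lin_indpt_family :: "nat \<Rightarrow> (nat \<Rightarrow> complex vec) \<Rightarrow> nat set \<Rightarrow> bool" where
  "lin_indpt_family N v I \<longleftrightarrow>
     inj_on v I \<and> \<not> module.lin_dep class_ring (module_vec TYPE(complex) N) (v ` I)"

end

theory Submission
  imports Defs
begin

text \<open>
  By definition \<open>T\<^sub>i g\<close> is a linear combination of those \<open>\<chi>\<^sub>l\<close> for which the transform of \<open>g\<close>
  does not vanish at \<open>l\<close>. Hence \<open>m\<close> independent translates lie in the span of these eigenvectors,
  and by the exchange theorem there are at least \<open>m\<close> of them.
\<close>

context vec_space
begin

text \<open>Summing over indices rather than over a set of vectors allows \<open>v\<close> to take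
  the same value twice; induction on \<open>S\<close> then needs only closure of the span under sums
  and multiples.\<close>

lemma vec_sum_in_span:
  assumes "finite S" "v ` S \<subseteq> carrier_vec n"
  shows "vec n (\<lambda>k. \<Sum>l\<in>S. c l * v l $ k) \<in> span (v ` S)"
  using assms
proof (induction S rule: finite_induct)
  case empty
  have "vec n (\<lambda>k. 0) = 0\<^sub>v n" by auto
  then show ?case by (simp add: span_empty)
next
  case (insert x F)
  have "vec n (\<lambda>k. \<Sum>l\<in>F. c l * v l $ k) \<in> span (v ` insert x F)"
    using insert by (auto intro: subsetD[OF span_is_monotone, of "v ` F"])
  moreover have "c x \<cdot>\<^sub>v v x \<in> span (v ` insert x F)"
    using insert.prems by (intro smult_in_span) (auto intro: span_mem)
  moreover have "vec n (\<lambda>k. \<Sum>l\<in>insert x F. c l * v l $ k) =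
      c x \<cdot>\<^sub>v v x + vec n (\<lambda>k. \<Sum>l\<in>F. c l * v l $ k)"
    using insert by (intro eq_vecI) auto
  ultimately show ?case
    using insert.prems by (simp add: span_add1)
qed

text \<open>The exchange theorem completes \<open>B\<close> to a spanning set of
  \<open>span A\<close> by at most \<open>card A - card B\<close> vectors, an integer difference
  that therefore cannot be negative.\<close>

lemma card_le_if_lin_indpt_in_span:
  assumes "finite A" "finite B" "A \<subseteq> carrier_vec n" "\<not> lin_dep B" "B \<subseteq> span A"
  shows "card B \<le> card A"
  using replacement[of B A] assms by fastforce

end

lemma gtranslate_in_span:
  assumes "\<chi> ` {..<N} \<subseteq> carrier_vec N"
  shows "gtranslate N \<chi> i g \<in>
    LinearCombinations.module.span class_ring (module_vec TYPE(complex) N)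
      (\<chi> ` {l. l < N \<and> gft N \<chi> g l \<noteq> 0})"
proof -
  interpret vec_space "TYPE(complex)" N .
  let ?S = "{l. l < N \<and> gft N \<chi> g l \<noteq> 0}"
  let ?c = "\<lambda>l. complex_of_real (sqrt (real N)) * (gft N \<chi> g l * gft N \<chi> (unit_vec N i) l)"
  \<comment> \<open>The factor \<open>sqrt N\<close> moves into the coefficients, and terms outside
    \<open>?S\<close> drop out because \<open>gft N \<chi> g l\<close> divides each of them.\<close>
  have "gtranslate N \<chi> i g = vec N (\<lambda>n. \<Sum>l\<in>?S. ?c l * \<chi> l $ n)"
    by (auto simp: gtranslate_def gconv_def sum_distrib_left mult.assoc
        intro!: eq_vecI sum.mono_neutral_right)
  then show ?thesis
    using vec_sum_in_span[of ?S \<chi> ?c] assms by auto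
qed

theorem theorem4p2:
  fixes N m :: nat
    and G :: "nat pair_pre_digraph"
    and w :: "(nat \<times> nat) weight_fun"
    and A :: "complex mat"
    and ev :: "nat \<Rightarrow> complex"
    and \<chi> :: "nat \<Rightarrow> complex vec"
    and g :: "complex vec"
  assumes "connected_weighted_graph N G w"
    and "A \<in> carrier_mat N N"
    and "diagonalizable A"
    and "char_poly A = (\<Prod>l<N. [:- ev l, 1:])"
    and "\<forall>l<N. eigenvector A (\<chi> l) (ev l)"
    and "orthonormal_basis N \<chi>"
    and "g \<in> carrier_vec N"
    and "m \<le> N"
    and "lin_indpt_family N (\<lambda>i. gtranslate N \<chi> i g) {..<m}"
  shows "\<exists>l :: nat \<Rightarrow> nat. inj_on l {..<m} \<and> l ` {..<m} \<subseteq> {..<N} \<and>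
           (\<forall>k<m. gft N \<chi> g (l k) \<noteq> 0)"
proof -
  interpret vec_space "TYPE(complex)" N .
  let ?S = "{l. l < N \<and> gft N \<chi> g l \<noteq> 0}"
  let ?T = "\<lambda>i. gtranslate N \<chi> i g"
  \<comment> \<open>The basis condition is what fixes the dimension of the eigenvectors
    here.\<close>
  have \<chi>: "\<chi> ` {..<N} \<subseteq> carrier_vec N"
    using \<open>orthonormal_basis N \<chi>\<close> by (auto simp: orthonormal_basis_def basis_def)
  have T: "inj_on ?T {..<m}" "\<not> lin_dep (?T ` {..<m})"
    using \<open>lin_indpt_family N ?T {..<m}\<close> by (simp_all add: lin_indpt_family_def)
  \<comment> \<open>Injectivity of the family ensures that passing to the set of translates loses
    none of the \<open>m\<close> members.\<close>
  have "m = card (?T ` {..<m})"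
    using T by (simp add: card_image)
  also have "\<dots> \<le> card (\<chi> ` ?S)"
    using \<chi> T gtranslate_in_span[OF \<chi>]
    by (intro card_le_if_lin_indpt_in_span) auto
  also have "\<dots> \<le> card ?S"
    by (simp add: card_image_le)
  finally have "card {..<m} \<le> card ?S"
    by simp
  \<comment> \<open>Comparing cardinalities gives an injection into \<open>?S\<close>, and its
    values are the required distinct indices.\<close>
  then obtain l where "l ` {..<m} \<subseteq> ?S" "inj_on l {..<m}"
    using card_le_inj[of "{..<m}" ?S] by auto
  then show ?thesis
    by (intro exI[of _ l]) auto
qed

end
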